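(* Let $\mathbf{n}=(n_1,\ldots,n_d)\in\mathbb{N}^d$ have pairwise relatively prime entries, let $\boldsymbol{\kappa}\in\mathbb{Z}^d$, and let $P:[-1,1]^d\to\mathbb{C}$ be a $d$-variate polynomial function. Suppose that $\langle P,T_{\boldsymbol{\gamma}}\rangle=0$ for all $\boldsymbol{\gamma}\in\mathbb{N}_0^d\setminus\{\mathbf{0}\}$ for which there exists $\mathbf{h}\in\mathbb{N}_0^d$ with $\gamma_i=2h_in_i$ for $i=1,\ldots,d$ and $\sum_{i=1}^dh_i\in 2\mathbb{N}_0$. Then $$\frac{1}{\pi^d}\int_{[-1,1]^d}P(\mathbf{x})\,w_d(\mathbf{x})\,d\mathbf{x}=\sum_{\mathbf{i}\in I^{(2\mathbf{n})}_{\boldsymbol{\kappa}}}\mathfrak{w}^{(2\mathbf{n})}_{\boldsymbol{\kappa},\mathbf{i}}\,P(\mathbf{z}^{(2\mathbf{n})}_{\mathbf{i}}).$$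
   Context: $\mathbb{N}=\{1,2,\ldots\}$, $\mathbb{N}_0=\mathbb{N}\cup\{0\}$, $d\in\mathbb{N}$, $p[\mathbf{n}]=\prod_{j=1}^dn_j$. $T_{\boldsymbol{\gamma}}(\mathbf{x})=\prod_{i=1}^dT_{\gamma_i}(x_i)$ with $T_\gamma(x)=\cos(\gamma\arccos x)$. $w_d(\mathbf{x})=\prod_{i=1}^d(1-x_i^2)^{-1/2}$ and $\langle f,g\rangle=\frac{1}{\pi^d}\int_{[-1,1]^d}f(\mathbf{x})\overline{g(\mathbf{x})}w_d(\mathbf{x})\,d\mathbf{x}$. For $\mathfrak{r}\in\{0,1\}$ let $I^{(2\mathbf{n})}_{\boldsymbol{\kappa},\mathfrak{r}}$ be the set of all $\mathbf{i}\in\mathbb{N}_0^d$ with $0\le i_j\le 2n_j$ and $i_j\equiv\kappa_j+\mathfrak{r}\bmod 2$ for all $j$, and $I^{(2\mathbf{n})}_{\boldsymbol{\kappa}}=I^{(2\mathbf{n})}_{\boldsymbol{\kappa},0}\cup I^{(2\mathbf{n})}_{\boldsymbol{\kappa},1}$. For $\mathbf{i}\in I^{(2\mathbf{n})}_{\boldsymbol{\kappa}}$, $\mathbf{z}^{(2\mathbf{n})}_{\mathbf{i}}=(\cos(i_1\pi/(2n_1)),\ldots,\cos(i_d\pi/(2n_d)))$ and $\mathfrak{w}^{(2\mathbf{n})}_{\boldsymbol{\kappa},\mathbf{i}}=2^{\#M}/(2^{d+1}p[\mathbf{n}])$, where $M=\{j\mid 0<i_j<2n_j\}$. *)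

theory Defs
  imports "HOL-Analysis.Analysis" "HOL-Number_Theory.Cong"
begin

text \<open>
  The dimension \<open>d\<close> is \<open>CARD('d)\<close>. Points are vectors in \<open>real ^ 'd\<close>; multi-indices (elements of
  \<open>\<nat>\<^sub>0\<^sup>d\<close>, \<open>\<nat>\<^sup>d\<close> or \<open>\<int>\<^sup>d\<close>) are functions on the index type \<open>'d\<close>.
\<close>

definition sym_cube :: "(real ^ 'd) set" where
  "sym_cube = cbox (\<chi> j. -1) (\<chi> j. 1)"

definition cheb :: "nat \<Rightarrow> real \<Rightarrow> real" where
  "cheb \<gamma> x = cos (real \<gamma> * arccos x)"

definition mcheb :: "('d::finite \<Rightarrow> nat) \<Rightarrow> real ^ 'd \<Rightarrow> real" where
  "mcheb \<gamma> x = (\<Prod>i\<in>UNIV. cheb (\<gamma> i) (x $ i))"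

text \<open>On the null set of points of the cube with some \<open>\<bar>x\<^sub>i\<bar> = 1\<close>, where the weight is
  infinite on paper, this function has the value 0.\<close>

definition cheb_weight :: "real ^ 'd::finite \<Rightarrow> real" where
  "cheb_weight x = (\<Prod>i\<in>UNIV. (1 - (x $ i)\<^sup>2) powr (- (1/2)))"

definition cheb_integral :: "(real ^ 'd::finite \<Rightarrow> complex) \<Rightarrow> complex" where
  "cheb_integral f =
     1 / of_real (pi ^ CARD('d)) *
       set_lebesgue_integral lborel sym_cube (\<lambda>x. f x * of_real (cheb_weight x))"

definition cheb_inner :: "(real ^ 'd::finite \<Rightarrow> complex) \<Rightarrow> (real ^ 'd \<Rightarrow> complex) \<Rightarrow> complex" where
  "cheb_inner f g = cheb_integral (\<lambda>x. f x * cnj (g x))"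

text \<open>The index set, the nodes and the weights belong to the grid with parameter \<open>2n\<close>: below,
  \<open>n\<close> is the multi-index with pairwise coprime entries, and the factor 2 is built in.\<close>

definition node_indices_parity ::
  "('d::finite \<Rightarrow> nat) \<Rightarrow> ('d \<Rightarrow> int) \<Rightarrow> nat \<Rightarrow> ('d \<Rightarrow> nat) set" where
  "node_indices_parity n \<kappa> r =
     {i. \<forall>j. i j \<le> 2 * n j \<and> [int (i j) = \<kappa> j + int r] (mod 2)}"

definition node_indices :: "('d::finite \<Rightarrow> nat) \<Rightarrow> ('d \<Rightarrow> int) \<Rightarrow> ('d \<Rightarrow> nat) set" where
  "node_indices n \<kappa> = node_indices_parity n \<kappa> 0 \<union> node_indices_parity n \<kappa> 1"

definition node :: "('d::finite \<Rightarrow> nat) \<Rightarrow> ('d \<Rightarrow> nat) \<Rightarrow> real ^ 'd" where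
  "node n i = (\<chi> j. cos (real (i j) * pi / (2 * real (n j))))"

definition node_weight :: "('d::finite \<Rightarrow> nat) \<Rightarrow> ('d \<Rightarrow> nat) \<Rightarrow> real" where
  "node_weight n i =
     2 ^ card {j. 0 < i j \<and> i j < 2 * n j} / (2 ^ (CARD('d) + 1) * real (\<Prod>j\<in>UNIV. n j))"

end

theory Submission
  imports Defs
begin

text \<open>
  On the cube, \<open>P\<close> is a finite linear combination of the \<open>T\<^sub>\<gamma>\<close>, because products of Chebyshev
  polynomials linearise by \<open>2 T\<^sub>k T\<^sub>l = T\<^bsub>k+l\<^esub> + T\<^bsub>\<bar>k-l\<bar>\<^esub>\<close>. The integral selects the coefficient of
  \<open>T\<^sub>0\<close>. The sum over each of the two parity classes of nodes factorises into one-dimensional cosine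
  sums, which vanish unless \<open>2 n\<^sub>i\<close> divides \<open>\<gamma>\<^sub>i\<close>. If \<open>\<gamma>\<^sub>i = 2 h\<^sub>i n\<^sub>i\<close> for all \<open>i\<close>, the two classes
  contribute values of equal modulus with relative sign \<open>(-1)\<close> to the power \<open>\<Sum>h\<^sub>i\<close>, so they cancel
  unless that sum is even; the corresponding coefficients of \<open>P\<close> vanish by orthogonality.
\<close>

section \<open>Chebyshev polynomials in one variable\<close>

lemma cheb_0 [simp]: "cheb 0 x = 1"
  by (simp add: cheb_def)

lemma cheb_1: "\<bar>x\<bar> \<le> 1 \<Longrightarrow> cheb 1 x = x"
  by (simp add: cheb_def abs_le_iff)

lemma cheb_cos: "\<lbrakk>0 \<le> t; t \<le> pi\<rbrakk> \<Longrightarrow> cheb k (cos t) = cos (real k * t)"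
  by (simp add: cheb_def arccos_cos)

text \<open>The product formula for cosines at the angle \<open>arccos x\<close>. At most one of the
  two truncated differences is nonzero, so their sum is the natural number |k - l|.\<close>

lemma cheb_mult: "cheb k x * cheb l x = (cheb (k + l) x + cheb ((k - l) + (l - k)) x) / 2"
proof (cases "l \<le> k")
  case True
  then show ?thesis
    by (simp add: cheb_def cos_times_cos of_nat_diff algebra_simps)
next
  case False
  then have "cos (real k * arccos x - real l * arccos x) = cos (real l * arccos x - real k * arccos x)"
    by (metis cos_minus minus_diff_eq)
  with False show ?thesis
    by (simp add: cheb_def cos_times_cos of_nat_diff algebra_simps)
qed

section \<open>Weighted integrals in one variable and over products\<close>

text \<open>The integrand has an elementary antiderivative but may blow up at both ends, so the
  fundamental theorem is applied on the open interval with one-sided limits.\<close>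

lemma has_bochner_integral_cheb:
  "has_bochner_integral lborel
     (\<lambda>x. indicator {-1..1} x * (cheb k x * (1 - x\<^sup>2) powr (- (1/2)))) (if k = 0 then pi else 0)"
proof -
  define f where "f k x = cos (real k * arccos x) * inverse (sqrt (1 - x\<^sup>2))" for k x
  \<comment> \<open>The antiderivative of \<open>f k\<close>; dividing by \<open>k\<close> forces
    the separate case \<open>k = 0\<close>.\<close>
  define F where "F k x = (if k = 0 then - arccos x else - sin (real k * arccos x) / real k)" for k x
  have pos: "0 < 1 - x\<^sup>2" if "-1 < x" "x < 1" for x :: real
    using that by (simp add: abs_square_less_1)
  have F: "(F k has_real_derivative f k x) (at x)" if "-1 < x" "x < 1" for x k
    using that pos[of x] unfolding F_def[abs_def] f_def
    by (cases "k = 0") (auto intro!: derivative_eq_intros DERIV_arccos simp: divide_simps)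
  have f: "isCont (f k) x" if "-1 < x" "x < 1" for x k
    using that pos[of x] unfolding f_def[abs_def]
    by (auto intro!: continuous_intros isCont_arccos)
  have cont: "continuous_on {-1..1} (F k)" for k
    unfolding F_def[abs_def] by (cases "k = 0") (auto intro!: continuous_intros)
  have lim: "((F k \<circ> real_of_ereal) \<longlongrightarrow> F k (-1)) (at_right (ereal (-1)))"
    "((F k \<circ> real_of_ereal) \<longlongrightarrow> F k 1) (at_left (ereal 1))" for k
    unfolding ereal_tendsto_simps1
    using continuous_on_Icc_at_rightD[OF cont] continuous_on_Icc_at_leftD[OF cont] by simp_all
  have set: "einterval (ereal (-1)) (ereal 1) = {-1<..<1}"
    by (simp add: einterval_eq)
  have nonneg: "AE x in lborel. ereal (-1) < ereal x \<longrightarrow> ereal x < ereal 1 \<longrightarrow> 0 \<le> f 0 x"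
    by (rule AE_I2) (auto simp: f_def abs_square_le_1)
  \<comment> \<open>For \<open>k = 0\<close> the integrand is nonnegative, so the fundamental
    theorem also yields integrability. This case then dominates all others, since a cosine is at
    most 1 in modulus.\<close>
  have int0: "set_integrable lborel {-1<..<1} (f 0)"
    unfolding set[symmetric]
    by (rule interval_integral_FTC_nonneg(1)[OF _ F f nonneg lim]) (auto simp del: uminus_ereal.simps)
  have intk: "set_integrable lborel {-1<..<1} (f k)"
  proof (rule set_integrable_bound[OF int0])
    have "f k \<in> borel_measurable (restrict_space borel {-1<..<1})"
      by (intro borel_measurable_continuous_on_restrict continuous_at_imp_continuous_on) (auto intro: f)
    then show "set_borel_measurable lborel {-1<..<1} (f k)"
      by (simp add: set_borel_measurable_def borel_measurable_restrict_space_iff)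
    show "AE x in lborel. x \<in> {-1<..<1} \<longrightarrow> norm (f k x) \<le> norm (f 0 x)"
      by (rule AE_I2) (simp add: f_def abs_mult mult_left_le_one_le)
  qed
  have "(LBINT x=ereal (-1)..ereal 1. f k x) = F k 1 - F k (-1)"
    by (rule interval_integral_FTC_integrable[OF _ _ f _ lim])
       (use F intk in \<open>auto simp: set has_real_derivative_iff_has_vector_derivative[symmetric]
          simp del: uminus_ereal.simps\<close>)
  moreover have "F k 1 - F k (-1) = (if k = 0 then pi else 0)"
    by (simp add: F_def)
  ultimately have "(LBINT x:{-1<..<1}. f k x) = (if k = 0 then pi else 0)"
    by (simp add: interval_lebesgue_integral_def set del: uminus_ereal.simps)
  with intk have "has_bochner_integral lborel (\<lambda>x. indicator {-1<..<1} x *\<^sub>R f k x) (if k = 0 then pi else 0)"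
    by (simp add: has_bochner_integral_iff set_integrable_def set_lebesgue_integral_def)
  moreover have "indicator {-1<..<1} x *\<^sub>R f k x =
      indicator {-1..1} x * (cheb k x * (1 - x\<^sup>2) powr (- (1/2)))" for x :: real
  proof (cases "-1 < x \<and> x < 1")
    case True
    then show ?thesis
      using pos[of x] by (simp add: f_def cheb_def powr_minus powr_half_sqrt)
  next
    \<comment> \<open>At the end points the closed interval still matches the open one, because
      \<open>0 powr a\<close> is 0.\<close>
    case False
    then show ?thesis
      by (cases "x = 1 \<or> x = -1") (auto simp: indicator_def)
  qed
  ultimately show ?thesis
    by simp
qed

text \<open>Fubini for a product of functions of single coordinates: \<open>lborel\<close> on
  vectors is the image of the product measure indexed by the basis vectors.\<close>

lemma has_bochner_integral_lborel_prod_vec: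
  fixes f :: "'d::finite \<Rightarrow> real \<Rightarrow> real"
  assumes "\<And>i. has_bochner_integral lborel (f i) (I i)"
  shows "has_bochner_integral lborel (\<lambda>x::real^'d. \<Prod>i\<in>UNIV. f i (x $ i)) (\<Prod>i\<in>UNIV. I i)"
proof -
  \<comment> \<open>Recovers the coordinate from its basis vector, to pass between products over
    \<open>Basis\<close> and over the index type.\<close>
  define ix :: "real^'d \<Rightarrow> 'd" where "ix b = (THE i. b = axis i 1)" for b
  have ix [simp]: "ix (axis i 1) = i" for i
    by (auto simp: ix_def axis_eq_axis)
  have int: "integrable lborel (f i)" and val: "integral\<^sup>L lborel (f i) = I i" for i
    using assms[of i] by (auto simp: has_bochner_integral_iff)
  have [measurable]: "f i \<in> borel_measurable borel" for i
    using int[of i] by auto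
  have Basis: "(Basis :: (real^'d) set) = range (\<lambda>i. axis i 1)"
    by (auto simp: Basis_vec_def)
  have inj: "inj (\<lambda>i. axis i 1 :: real^'d)"
    by (auto simp: inj_on_def axis_eq_axis)
  have comp: "(\<Sum>b\<in>Basis. y b *\<^sub>R b) $ i = y (axis i 1)" for y :: "real^'d \<Rightarrow> real" and i
    by (subst cart_eq_inner_axis) (auto simp: inner_sum_left inner_Basis Basis if_distrib cong: if_cong)
  interpret product_sigma_finite "\<lambda>_::real^'d. lborel :: real measure"
    by standard
  have "has_bochner_integral (\<Pi>\<^sub>M b\<in>(Basis::(real^'d) set). lborel)
      (\<lambda>y. \<Prod>b\<in>Basis. f (ix b) (y b)) (\<Prod>b\<in>(Basis::(real^'d) set). I (ix b))"
    unfolding has_bochner_integral_iff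
    using product_integrable_prod[of Basis "\<lambda>b. f (ix b)"] product_integral_prod[of Basis "\<lambda>b. f (ix b)"]
    by (simp add: int val)
  then have "has_bochner_integral (\<Pi>\<^sub>M b\<in>(Basis::(real^'d) set). lborel)
      (\<lambda>y. \<Prod>i\<in>UNIV. f i ((\<Sum>b\<in>Basis. y b *\<^sub>R b) $ i)) (\<Prod>i\<in>UNIV. I i)"
    unfolding comp by (simp add: Basis prod.reindex[OF inj])
  then show ?thesis
    by (subst lborel_eq) (simp add: has_bochner_integral_iff integrable_distr_eq integral_distr)
qed

section \<open>Cosine sums on the one-dimensional grid\<close>

text \<open>
  On the interior grid points of fixed parity the weight is 2, on the end points 1: the even points
  give the trapezoidal rule and the odd points the midpoint rule with step 2.
\<close>

lemma sum_even_trapezoid: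
  fixes f :: "nat \<Rightarrow> real"
  assumes "n \<ge> 1"
  shows "(\<Sum>i | i \<le> 2 * n \<and> even i. (if 0 < i \<and> i < 2 * n then 2 else 1) * f i) =
    (\<Sum>k<n. f (2 * k) + f (2 * k + 2))"
proof -
  let ?A = "{i. i \<le> 2 * n \<and> even i}"
  \<comment> \<open>The weight counts the cells of length 2 that a point bounds:
    \<open>i < 2 * n\<close> as left end, \<open>0 < i\<close> as right end.\<close>
  have "(\<Sum>i\<in>?A. (if 0 < i \<and> i < 2 * n then 2 else 1) * f i) =
      (\<Sum>i\<in>?A. (if i < 2 * n then f i else 0) + (if 0 < i then f i else 0))"
    using assms by (intro sum.cong) auto
  also have "\<dots> = (\<Sum>i | i \<in> ?A \<and> i < 2 * n. f i) + (\<Sum>i | i \<in> ?A \<and> 0 < i. f i)"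
    by (simp add: sum.distrib sum.If_cases Int_def)
  also have "(\<Sum>i | i \<in> ?A \<and> i < 2 * n. f i) = (\<Sum>k<n. f (2 * k))"
    by (rule sum.reindex_bij_witness[where i = "\<lambda>k. 2 * k" and j = "\<lambda>i. i div 2"]) auto
  also have "(\<Sum>i | i \<in> ?A \<and> 0 < i. f i) = (\<Sum>k<n. f (2 * k + 2))"
    by (rule sum.reindex_bij_witness[where i = "\<lambda>k. 2 * k + 2" and j = "\<lambda>i. i div 2 - 1"])
       (auto elim!: evenE intro!: arg_cong[of _ _ f])
  finally show ?thesis
    by (simp add: sum.distrib)
qed

lemma sum_odd_midpoint:
  fixes f :: "nat \<Rightarrow> real"
  shows "(\<Sum>i | i \<le> 2 * n \<and> odd i. (if 0 < i \<and> i < 2 * n then 2 else 1) * f i) =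
    (\<Sum>k<n. 2 * f (2 * k + 1))"
  by (rule sum.reindex_bij_witness[where i = "\<lambda>k. 2 * k + 1" and j = "\<lambda>i. i div 2"])
     (auto simp: le_less odd_pos)

text \<open>Telescoping sum: 2 sin \<theta> cos \<phi> = sin (\<phi> + \<theta>) - sin (\<phi> -
  \<theta>), with \<phi> running through the odd multiples of \<theta>.\<close>

lemma sin_times_sum_cos_odd:
  "sin \<theta> * (\<Sum>k<m. 2 * cos (real (2 * k + 1) * \<theta>)) = sin (2 * real m * \<theta>)"
proof (induction m)
  case (Suc m)
  define \<phi> where "\<phi> = real (2 * m + 1) * \<theta>"
  have "sin (2 * real (Suc m) * \<theta>) = sin (\<phi> + \<theta>)" "sin (2 * real m * \<theta>) = sin (\<phi> - \<theta>)"
    by (simp_all add: \<phi>_def algebra_simps)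
  moreover have "sin (\<phi> + \<theta>) = sin (\<phi> - \<theta>) + sin \<theta> * (2 * cos \<phi>)"
    by (simp add: sin_add sin_diff)
  ultimately show ?case
    using Suc by (simp only: sum.lessThan_Suc distrib_left \<phi>_def)
qed simp

text \<open>The value \<open>cos (h a \<pi>)\<close>.\<close>

definition parity_sign :: "nat \<Rightarrow> int \<Rightarrow> real" where
  "parity_sign h a = (if odd h \<and> odd a then -1 else 1)"

text \<open>Both parities reduce to the sum \<open>?odd\<close> of cosines at odd multiples of
  \<open>\<theta>\<close>, the even one with an extra factor cos \<theta>. The sum telescopes to a
  multiple of sin (\<gamma> \<pi>) = 0 after multiplication by sin \<theta>, which vanishes only if
  2 n divides \<gamma>.\<close>

lemma sum_cos_grid:
  assumes "n \<ge> 1"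
  shows "(\<Sum>i | i \<le> 2 * n \<and> [int i = a] (mod 2).
      (if 0 < i \<and> i < 2 * n then 2 else 1) * cos (real \<gamma> * (real i * pi / (2 * real n)))) =
    (if 2 * n dvd \<gamma> then 2 * real n * parity_sign (\<gamma> div (2 * n)) a else 0)"
proof -
  define \<theta> where "\<theta> = real \<gamma> * pi / (2 * real n)"
  let ?w = "\<lambda>i. if 0 < i \<and> i < 2 * n then 2 else 1 :: real"
  let ?odd = "\<Sum>k<n. 2 * cos (real (2 * k + 1) * \<theta>)"
  have parity: "[int i = a] (mod 2) \<longleftrightarrow> (even i \<longleftrightarrow> even a)" for i
    unfolding cong_def by presburger
  have \<theta>: "real \<gamma> * (real i * pi / (2 * real n)) = real i * \<theta>" for i
    by (simp add: \<theta>_def)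
  have sum: "(\<Sum>i | i \<le> 2 * n \<and> [int i = a] (mod 2). ?w i * cos (real i * \<theta>)) =
      (if even a then cos \<theta> else 1) * ?odd"
  proof (cases "even a")
    case True
    \<comment> \<open>The two ends of a cell lie at angle \<open>\<theta>\<close> on either side of
      its midpoint.\<close>
    have "cos (real (2 * k) * \<theta>) + cos (real (2 * k + 2) * \<theta>) = cos \<theta> * (2 * cos (real (2 * k + 1) * \<theta>))" for k
    proof -
      have *: "real (2 * k) * \<theta> = real (2 * k + 1) * \<theta> - \<theta>" "real (2 * k + 2) * \<theta> = real (2 * k + 1) * \<theta> + \<theta>"
        by (simp_all add: algebra_simps)
      show ?thesis
        unfolding * cos_add cos_diff by simp
    qed
    then show ?thesis
      using True sum_even_trapezoid[OF assms, of "\<lambda>i. cos (real i * \<theta>)"]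
      by (simp add: parity sum_distrib_left)
  next
    case False
    then show ?thesis
      using sum_odd_midpoint[of n "\<lambda>i. cos (real i * \<theta>)"] by (simp add: parity)
  qed
  show ?thesis
  proof (cases "2 * n dvd \<gamma>")
    case True
    then obtain h where h: "\<gamma> = 2 * n * h" ..
    have "\<theta> = real h * pi"
      using assms by (simp add: \<theta>_def h)
    then have \<theta>_mult: "real m * \<theta> = real (m * h) * pi" for m
      by simp
    \<comment> \<open>Odd multiples of h \<pi> all have cosine (-1)^h. For even \<open>a\<close> the
      factor cos \<theta> squares this sign away.\<close>
    have "cos (real (2 * k + 1) * \<theta>) = (-1) ^ h" for k
      unfolding \<theta>_mult cos_npi by (simp add: power_add power_mult)
    moreover have "cos \<theta> = (-1) ^ h"
      using calculation[of 0] by simp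
    ultimately show ?thesis
      unfolding \<theta> sum using assms by (auto simp: h parity_sign_def)
  next
    case False
    have "sin \<theta> \<noteq> 0"
    proof
      assume "sin \<theta> = 0"
      then obtain m :: int where "\<theta> = of_int m * pi"
        by (auto simp: sin_zero_iff_int2)
      then have "real \<gamma> = of_int m * (2 * real n)"
        using assms by (simp add: \<theta>_def field_simps)
      then have "real_of_int (int \<gamma>) = real_of_int (m * int (2 * n))"
        by simp
      then have "int \<gamma> = m * int (2 * n)"
        unfolding of_int_eq_iff .
      then have "int (2 * n) dvd int \<gamma>"
        by simp
      with False show False
        by (simp only: int_dvd_int_iff)
    qed
    moreover have "sin \<theta> * ?odd = 0"
      using sin_times_sum_cos_odd[of \<theta> n] sin_npi[of \<gamma>] assms
      by (simp add: \<theta>_def mult.commute del: sin_npi)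
    ultimately show ?thesis
      unfolding \<theta> sum using False by simp
  qed
qed

section \<open>Integration against the Chebyshev weight on the cube\<close>

text \<open>Carries integrability together with the normalised value, so that linearity needs no
  side conditions.\<close>

definition has_cheb_integral :: "(real ^ 'd::finite \<Rightarrow> complex) \<Rightarrow> complex \<Rightarrow> bool" where
  "has_cheb_integral f I \<longleftrightarrow>
     has_bochner_integral lborel (\<lambda>x. indicator sym_cube x *\<^sub>R (f x * of_real (cheb_weight x)))
       (of_real (pi ^ CARD('d)) * I)"

lemma cheb_integral_eq: "has_cheb_integral f I \<Longrightarrow> cheb_integral f = I"
  by (simp add: has_cheb_integral_def cheb_integral_def set_lebesgue_integral_def
      has_bochner_integral_iff)

lemma has_cheb_integral_cong:
  assumes "has_cheb_integral f I" "\<And>x. x \<in> sym_cube \<Longrightarrow> g x = f x"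
  shows "has_cheb_integral g I"
proof -
  have "(\<lambda>x. indicator sym_cube x *\<^sub>R (g x * of_real (cheb_weight x))) =
      (\<lambda>x. indicator sym_cube x *\<^sub>R (f x * of_real (cheb_weight x)))"
    by (auto simp: assms(2) split: split_indicator)
  with assms(1) show ?thesis
    unfolding has_cheb_integral_def by simp
qed

lemma has_cheb_integral_mult_right:
  assumes "has_cheb_integral f I"
  shows "has_cheb_integral (\<lambda>x. c * f x) (c * I)"
  using has_bochner_integral_mult_right[of c, OF assms[unfolded has_cheb_integral_def]]
  unfolding has_cheb_integral_def by (simp add: ac_simps)

lemma has_cheb_integral_sum:
  assumes "\<And>i. i \<in> S \<Longrightarrow> has_cheb_integral (f i) (I i)"
  shows "has_cheb_integral (\<lambda>x. \<Sum>i\<in>S. f i x) (\<Sum>i\<in>S. I i)"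
  using has_bochner_integral_sum[of S lborel, OF assms[unfolded has_cheb_integral_def]]
  unfolding has_cheb_integral_def by (simp add: scaleR_sum_right sum_distrib_left sum_distrib_right)

lemma mem_sym_cube: "x \<in> sym_cube \<longleftrightarrow> (\<forall>i. x $ i \<in> {-1..1})"
  by (simp add: sym_cube_def mem_box_cart)

text \<open>Indicator, weight and polynomial all factorise over the coordinates, and any coordinate
  with positive degree contributes the factor 0.\<close>

lemma has_cheb_integral_mcheb:
  fixes \<gamma> :: "'d::finite \<Rightarrow> nat"
  shows "has_cheb_integral (\<lambda>x. of_real (mcheb \<gamma> x)) (of_bool (\<gamma> = (\<lambda>_. 0)))"
proof -
  have ind: "(\<Prod>i\<in>UNIV. indicator {-1..1} (x $ i)) = (indicator sym_cube x :: real)" for x :: "real^'d"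
    by (auto simp: indicator_def mem_sym_cube)
  have "(\<Prod>i\<in>UNIV. if \<gamma> i = 0 then pi else 0) = pi ^ CARD('d) * of_bool (\<gamma> = (\<lambda>_. 0))"
    by (auto simp: fun_eq_iff)
  then have "has_bochner_integral lborel
      (\<lambda>x. indicator sym_cube x * (mcheb \<gamma> x * cheb_weight x)) (pi ^ CARD('d) * of_bool (\<gamma> = (\<lambda>_. 0)))"
    using has_bochner_integral_lborel_prod_vec[OF has_bochner_integral_cheb, of \<gamma>]
    by (simp add: prod.distrib ind mcheb_def cheb_weight_def)
  from has_bochner_integral_of_real[OF this, where 'a = complex] show ?thesis
    by (cases "\<gamma> = (\<lambda>_. 0)") (simp_all add: has_cheb_integral_def scaleR_conv_of_real)
qed

section \<open>Products of multivariate Chebyshev polynomials and orthogonality\<close>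

text \<open>
  The indices in the expansion of \<open>T\<^sub>\<gamma> T\<^sub>\<delta>\<close>: the sum of the two indices on \<open>B\<close>, and
  \<open>\<bar>\<gamma>\<^sub>i - \<delta>\<^sub>i\<bar>\<close>, written with truncated subtraction, off \<open>B\<close>.
\<close>

definition cheb_mix :: "('d \<Rightarrow> nat) \<Rightarrow> ('d \<Rightarrow> nat) \<Rightarrow> 'd set \<Rightarrow> 'd \<Rightarrow> nat" where
  "cheb_mix \<gamma> \<delta> B i = (if i \<in> B then \<gamma> i + \<delta> i else (\<gamma> i - \<delta> i) + (\<delta> i - \<gamma> i))"

text \<open>Expanding the product of the two-term sums given by \<open>cheb_mult\<close>:
  \<open>B\<close> records the coordinates where the first summand is chosen.\<close>

lemma mcheb_mult:
  fixes x :: "real ^ 'd::finite"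
  shows "mcheb \<gamma> x * mcheb \<delta> x = (\<Sum>B\<in>UNIV. (1 / 2 ^ CARD('d)) * mcheb (cheb_mix \<gamma> \<delta> B) x)"
proof -
  have "mcheb \<gamma> x * mcheb \<delta> x =
      (\<Prod>i\<in>UNIV. cheb (\<gamma> i + \<delta> i) (x $ i) + cheb ((\<gamma> i - \<delta> i) + (\<delta> i - \<gamma> i)) (x $ i)) / 2 ^ CARD('d)"
    by (simp add: mcheb_def prod.distrib[symmetric] cheb_mult prod_dividef)
  also have "\<dots> = (\<Sum>B\<in>UNIV. mcheb (cheb_mix \<gamma> \<delta> B) x) / 2 ^ CARD('d)"
    by (simp add: prod_add mcheb_def cheb_mix_def if_distrib[of "\<lambda>k. cheb k _"] prod.If_cases
        Compl_eq_Diff_UNIV)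
  finally show ?thesis
    by (simp add: sum_divide_distrib)
qed

lemma cheb_mix_eq_0_iff: "cheb_mix \<gamma> \<delta> B = (\<lambda>_. 0) \<longleftrightarrow> \<gamma> = \<delta> \<and> (\<forall>i\<in>B. \<gamma> i = 0)"
  by (auto simp: cheb_mix_def fun_eq_iff split: if_splits) (metis add_is_0 diff_is_0_eq le_antisym)+

text \<open>Only terms with \<open>cheb_mix\<close> equal to 0 survive, that is, \<gamma> = \<delta>
  with \<open>B\<close> inside the zero set of \<gamma>. The count stays unevaluated, since later
  only its being nonzero matters.\<close>

lemma has_cheb_integral_mcheb_mult:
  "has_cheb_integral (\<lambda>x :: real ^ 'd::finite. of_real (mcheb \<gamma> x) * of_real (mcheb \<delta> x))
     (if \<gamma> = \<delta> then of_nat (card {B. \<forall>i\<in>B. \<gamma> i = 0}) / 2 ^ CARD('d) else 0)"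
proof -
  have "has_cheb_integral
      (\<lambda>x :: real ^ 'd. \<Sum>B\<in>UNIV. (1 / 2 ^ CARD('d)) * of_real (mcheb (cheb_mix \<gamma> \<delta> B) x))
      (\<Sum>B\<in>UNIV. (1 / 2 ^ CARD('d)) * of_bool (cheb_mix \<gamma> \<delta> B = (\<lambda>_. 0)))"
    by (intro has_cheb_integral_sum has_cheb_integral_mult_right has_cheb_integral_mcheb)
  moreover have "of_real (mcheb \<gamma> x) * of_real (mcheb \<delta> x) =
      (\<Sum>B\<in>UNIV. (1 / 2 ^ CARD('d)) * of_real (mcheb (cheb_mix \<gamma> \<delta> B) x) :: complex)" for x :: "real ^ 'd"
    unfolding of_real_mult[symmetric] mcheb_mult by simp
  moreover have "(\<Sum>B\<in>UNIV. (1 / 2 ^ CARD('d)) * of_bool (cheb_mix \<gamma> \<delta> B = (\<lambda>_. 0))) =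
      (if \<gamma> = \<delta> then of_nat (card {B. \<forall>i\<in>B. \<gamma> i = 0}) / 2 ^ CARD('d) else (0::complex))"
    by (simp add: cheb_mix_eq_0_iff flip: sum_divide_distrib)
  ultimately show ?thesis
    by simp
qed

section \<open>Expansion of polynomials in Chebyshev polynomials\<close>

text \<open>Equality is asked on the cube only: \<open>cheb\<close>, being defined through
  \<open>arccos\<close>, is used as a polynomial just on [-1,1].\<close>

definition mcheb_span :: "(real ^ 'd::finite \<Rightarrow> complex) \<Rightarrow> bool" where
  "mcheb_span f \<longleftrightarrow>
     (\<exists>S c. finite S \<and> (\<forall>x\<in>sym_cube. f x = (\<Sum>\<gamma>\<in>S. c \<gamma> * of_real (mcheb \<gamma> x))))"

lemma mcheb_spanI:
  assumes "finite S" "\<And>x. x \<in> sym_cube \<Longrightarrow> f x = (\<Sum>\<gamma>\<in>S. c \<gamma> * of_real (mcheb \<gamma> x))"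
  shows "mcheb_span f"
  using assms unfolding mcheb_span_def by blast

lemma mcheb_span_cong:
  assumes "mcheb_span f" "\<And>x. x \<in> sym_cube \<Longrightarrow> g x = f x"
  shows "mcheb_span g"
  using assms unfolding mcheb_span_def by simp

lemma mcheb_span_mcheb: "mcheb_span (\<lambda>x. of_real (mcheb \<gamma> x))"
  by (rule mcheb_spanI[of "{\<gamma>}" _ "\<lambda>_. 1"]) auto

lemma mcheb_span_0: "mcheb_span (\<lambda>_. 0)"
  by (rule mcheb_spanI[of "{}"]) auto

lemma mcheb_span_mult_right:
  assumes "mcheb_span f"
  shows "mcheb_span (\<lambda>x. a * f x)"
proof -
  from assms obtain S c where S: "finite S" "\<And>x. x \<in> sym_cube \<Longrightarrow> f x = (\<Sum>\<gamma>\<in>S. c \<gamma> * of_real (mcheb \<gamma> x))"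
    unfolding mcheb_span_def by blast
  show ?thesis
    by (rule mcheb_spanI[of S _ "\<lambda>\<gamma>. a * c \<gamma>"]) (auto simp: S sum_distrib_left mult.assoc)
qed

lemma mcheb_span_add:
  assumes "mcheb_span f" "mcheb_span g"
  shows "mcheb_span (\<lambda>x. f x + g x)"
proof -
  from assms obtain S c T e where
    S: "finite S" "\<And>x. x \<in> sym_cube \<Longrightarrow> f x = (\<Sum>\<gamma>\<in>S. c \<gamma> * of_real (mcheb \<gamma> x))" and
    T: "finite T" "\<And>x. x \<in> sym_cube \<Longrightarrow> g x = (\<Sum>\<gamma>\<in>T. e \<gamma> * of_real (mcheb \<gamma> x))"
    unfolding mcheb_span_def by blast
  \<comment> \<open>Padding with zero coefficients brings both expansions to a common index
    set.\<close>
  have extend: "(\<Sum>\<gamma>\<in>A. h \<gamma> * of_real (mcheb \<gamma> x)) =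
      (\<Sum>\<gamma>\<in>S \<union> T. (if \<gamma> \<in> A then h \<gamma> else 0) * of_real (mcheb \<gamma> x))"
    if "A \<subseteq> S \<union> T" for A and h :: "_ \<Rightarrow> complex" and x
    using that S(1) T(1) by (intro sum.mono_neutral_cong_left) auto
  show ?thesis
    by (rule mcheb_spanI[of "S \<union> T" _ "\<lambda>\<gamma>. (if \<gamma> \<in> S then c \<gamma> else 0) + (if \<gamma> \<in> T then e \<gamma> else 0)"])
       (simp_all add: S T extend[of S] extend[of T] distrib_right sum.distrib)
qed

lemma mcheb_span_sum:
  assumes "\<And>i. i \<in> S \<Longrightarrow> mcheb_span (f i)"
  shows "mcheb_span (\<lambda>x. \<Sum>i\<in>S. f i x)"
  using assms by (induction S rule: infinite_finite_induct) (auto intro: mcheb_span_0 mcheb_span_add)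

lemma mcheb_span_mult:
  fixes f g :: "real ^ 'd::finite \<Rightarrow> complex"
  assumes "mcheb_span f" "mcheb_span g"
  shows "mcheb_span (\<lambda>x. f x * g x)"
proof -
  from assms obtain S c T e where
    S: "\<And>x. x \<in> sym_cube \<Longrightarrow> f x = (\<Sum>\<gamma>\<in>S. c \<gamma> * of_real (mcheb \<gamma> x))" and
    T: "\<And>x. x \<in> sym_cube \<Longrightarrow> g x = (\<Sum>\<gamma>\<in>T. e \<gamma> * of_real (mcheb \<gamma> x))"
    unfolding mcheb_span_def by blast
  have "mcheb_span (\<lambda>x. \<Sum>\<gamma>\<in>S. \<Sum>\<delta>\<in>T. c \<gamma> * e \<delta> *
      (\<Sum>B\<in>UNIV. (1 / 2 ^ CARD('d)) * of_real (mcheb (cheb_mix \<gamma> \<delta> B) x)))"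
    by (intro mcheb_span_sum mcheb_span_mult_right mcheb_span_mcheb)
  then show ?thesis
  proof (rule mcheb_span_cong)
    fix x :: "real ^ 'd" assume x: "x \<in> sym_cube"
    have "(\<Sum>B\<in>UNIV. (1 / 2 ^ CARD('d)) * of_real (mcheb (cheb_mix \<gamma> \<delta> B) x)) =
        (of_real (mcheb \<gamma> x) * of_real (mcheb \<delta> x) :: complex)" for \<gamma> \<delta>
      unfolding of_real_mult[symmetric] mcheb_mult by simp
    then show "f x * g x = (\<Sum>\<gamma>\<in>S. \<Sum>\<delta>\<in>T. c \<gamma> * e \<delta> *
        (\<Sum>B\<in>UNIV. (1 / 2 ^ CARD('d)) * of_real (mcheb (cheb_mix \<gamma> \<delta> B) x)))"
      by (simp only: S[OF x] T[OF x] sum_product ac_simps)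
  qed
qed

lemma mcheb_span_const: "mcheb_span (\<lambda>_. a)"
  using mcheb_span_mult_right[OF mcheb_span_mcheb, of a "\<lambda>_. 0"] by (simp add: mcheb_def)

lemma mcheb_span_component: "mcheb_span (\<lambda>x :: real ^ 'd::finite. of_real (x $ i))"
proof (rule mcheb_span_cong[OF mcheb_span_mcheb])
  fix x :: "real ^ 'd" assume "x \<in> sym_cube"
  then have "\<bar>x $ i\<bar> \<le> 1"
    by (auto simp: mem_sym_cube abs_le_iff)
  \<comment> \<open>A coordinate is T_1 in that variable, so its multi-index is a unit
    vector.\<close>
  then show "complex_of_real (x $ i) = of_real (mcheb (\<lambda>j. if j = i then 1 else 0) x)"
    by (simp add: mcheb_def if_distrib[of "\<lambda>k. cheb k _"] cheb_1[unfolded One_nat_def] cong: if_cong)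
qed

lemma mcheb_span_real_polynomial_function:
  fixes p :: "real ^ 'd::finite \<Rightarrow> real"
  assumes "real_polynomial_function p"
  shows "mcheb_span (\<lambda>x. of_real (p x))"
  using assms
proof induction
  case (linear f)
  \<comment> \<open>A linear form is a combination of coordinates, which reduces this case to
    \<open>mcheb_span_component\<close>.\<close>
  have f_eq: "f x = (\<Sum>i\<in>UNIV. f (axis i 1) * x $ i)" for x
  proof -
    interpret bounded_linear f by fact
    have "f x = f (\<Sum>i\<in>UNIV. (x $ i) *\<^sub>R axis i 1)"
      unfolding scalar_mult_eq_scaleR[symmetric] basis_expansion ..
    then show ?thesis
      by (simp add: sum scaleR mult.commute)
  qed
  have "(\<lambda>x. complex_of_real (f x)) = (\<lambda>x. \<Sum>i\<in>UNIV. of_real (f (axis i 1)) * of_real (x $ i))"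
    by (rule ext, subst f_eq) simp
  then show ?case
    by (simp add: mcheb_span_sum mcheb_span_mult_right mcheb_span_component)
qed (auto intro: mcheb_span_const mcheb_span_add mcheb_span_mult)

lemma mcheb_span_polynomial_function:
  fixes P :: "real ^ 'd::finite \<Rightarrow> complex"
  assumes "polynomial_function P"
  shows "mcheb_span P"
proof -
  have "real_polynomial_function (Re \<circ> P)" "real_polynomial_function (Im \<circ> P)"
    using assms bounded_linear_Re bounded_linear_Im unfolding polynomial_function_def by blast+
  then have "mcheb_span (\<lambda>x. of_real (Re (P x)) + \<i> * of_real (Im (P x)))"
    by (auto dest!: mcheb_span_real_polynomial_function intro!: mcheb_span_add mcheb_span_mult_right)
  then show ?thesis
    by (simp flip: complex_eq)
qed

section \<open>Quadrature sums of Chebyshev polynomials\<close>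

text \<open>Within one parity class the coordinates are constrained independently, which lets a sum
  of products become a product of sums.\<close>

lemma node_indices_parity_PiE:
  "node_indices_parity n \<kappa> r =
     (\<Pi>\<^sub>E j\<in>UNIV. {i. i \<le> 2 * n j \<and> [int i = \<kappa> j + int r] (mod 2)})"
  by (auto simp: node_indices_parity_def PiE_def Pi_def)

lemma node_weight_prod:
  "node_weight n i =
     (\<Prod>j\<in>UNIV. if 0 < i j \<and> i j < 2 * n j then 2 else 1) / (2 ^ (CARD('d) + 1) * (\<Prod>j\<in>UNIV. real (n j)))"
  for n :: "'d::finite \<Rightarrow> nat"
  by (simp add: node_weight_def prod.If_cases)

text \<open>The bounds put each angle into [0, \<pi>], where \<open>arccos\<close> inverts the
  cosine.\<close>

lemma mcheb_node:
  assumes "\<And>j. n j \<ge> 1" "\<And>j. i j \<le> 2 * n j"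
  shows "mcheb \<gamma> (node n i) = (\<Prod>j\<in>UNIV. cos (real (\<gamma> j) * (real (i j) * pi / (2 * real (n j)))))"
proof -
  have "real (i j) * pi / (2 * real (n j)) \<le> pi" for j
  proof -
    have "real (i j) \<le> 2 * real (n j)"
      using assms(2)[of j] by linarith
    then have "real (i j) * pi \<le> 2 * real (n j) * pi"
      by (intro mult_right_mono) auto
    then show ?thesis
      using assms(1)[of j] by (simp add: divide_le_eq mult.commute)
  qed
  then show ?thesis
    by (simp add: mcheb_def node_def cheb_cos)
qed

text \<open>Weight and polynomial factorise, and \<open>sum_cos_grid\<close> gives a factor 2 n_j
  for each coordinate. Against the denominator of \<open>node_weight\<close> this leaves 1/2, the
  share of one parity class.\<close>

lemma sum_node_indices_parity_mcheb:
  fixes n :: "'d::finite \<Rightarrow> nat"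
  assumes n: "\<And>j. n j \<ge> 1"
  shows "(\<Sum>i\<in>node_indices_parity n \<kappa> r. node_weight n i * mcheb \<gamma> (node n i)) =
    (\<Prod>j\<in>UNIV. if 2 * n j dvd \<gamma> j then parity_sign (\<gamma> j div (2 * n j)) (\<kappa> j + int r) else 0) / 2"
proof -
  let ?A = "\<lambda>j. {i. i \<le> 2 * n j \<and> [int i = \<kappa> j + int r] (mod 2)}"
  let ?D = "2 ^ (CARD('d) + 1) * (\<Prod>j\<in>UNIV. real (n j))"
  let ?g = "\<lambda>j i. (if 0 < i \<and> i < 2 * n j then 2 else 1) * cos (real (\<gamma> j) * (real i * pi / (2 * real (n j))))"
  let ?s = "\<lambda>j. if 2 * n j dvd \<gamma> j then parity_sign (\<gamma> j div (2 * n j)) (\<kappa> j + int r) else 0"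
  have "(\<Sum>i\<in>node_indices_parity n \<kappa> r. node_weight n i * mcheb \<gamma> (node n i)) =
      (\<Sum>i\<in>PiE UNIV ?A. (\<Prod>j\<in>UNIV. ?g j (i j)) / ?D)"
    unfolding node_indices_parity_PiE
    by (intro sum.cong refl, subst mcheb_node) (auto simp: n[unfolded One_nat_def] node_weight_prod prod.distrib PiE_def)
  also have "\<dots> = (\<Prod>j\<in>UNIV. \<Sum>i\<in>?A j. ?g j i) / ?D"
    by (subst prod_sum_PiE) (auto simp: sum_divide_distrib)
  also have "(\<Prod>j\<in>UNIV. \<Sum>i\<in>?A j. ?g j i) = (\<Prod>j\<in>UNIV. 2 * real (n j) * ?s j)"
    by (intro prod.cong refl, subst sum_cos_grid) (auto simp: n[unfolded One_nat_def])
  also have "\<dots> = 2 ^ CARD('d) * (\<Prod>j\<in>UNIV. real (n j)) * (\<Prod>j\<in>UNIV. ?s j)"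
    by (simp add: prod.distrib)
  also have "\<dots> / ?D = (\<Prod>j\<in>UNIV. ?s j) / 2"
  proof -
    have "(\<Prod>j\<in>UNIV. real (n j)) \<noteq> 0"
      using n by (simp add: Suc_le_eq)
    then show ?thesis
      by (simp add: field_simps del: prod_zero_iff)
  qed
  finally show ?thesis .
qed

lemma sum_node_indices:
  fixes f :: "('d::finite \<Rightarrow> nat) \<Rightarrow> 'a::comm_monoid_add"
  shows "(\<Sum>i\<in>node_indices n \<kappa>. f i) =
    (\<Sum>i\<in>node_indices_parity n \<kappa> 0. f i) + (\<Sum>i\<in>node_indices_parity n \<kappa> 1. f i)"
  unfolding node_indices_def
proof (rule sum.union_disjoint)
  show "finite (node_indices_parity n \<kappa> 0)" "finite (node_indices_parity n \<kappa> 1)"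
    unfolding node_indices_parity_PiE by (auto intro!: finite_PiE)
  \<comment> \<open>The index type is inhabited, and at any one coordinate the two classes demand
    opposite parities.\<close>
  have "\<not> ([int a = k] (mod 2) \<and> [int a = k + 1] (mod 2))" for a k
    unfolding cong_def by presburger
  then show "node_indices_parity n \<kappa> 0 \<inter> node_indices_parity n \<kappa> 1 = {}"
    by (auto simp: node_indices_parity_def)
qed

lemma sum_node_indices_mcheb_0:
  assumes "\<And>j. n j \<ge> 1"
  shows "(\<Sum>i\<in>node_indices n \<kappa>. node_weight n i * mcheb (\<lambda>_. 0) (node n i)) = 1"
  unfolding sum_node_indices sum_node_indices_parity_mcheb[of n, OF assms]
  by (simp add: parity_sign_def)

lemma sum_node_indices_mcheb_eq_0:
  fixes n :: "'d::finite \<Rightarrow> nat"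
  assumes n: "\<And>j. n j \<ge> 1"
    and nex: "\<nexists>h. (\<forall>i. \<gamma> i = 2 * h i * n i) \<and> even (\<Sum>i\<in>UNIV. h i)"
  shows "(\<Sum>i\<in>node_indices n \<kappa>. node_weight n i * mcheb \<gamma> (node n i)) = 0"
proof (cases "\<forall>j. 2 * n j dvd \<gamma> j")
  \<comment> \<open>One failing divisibility puts a zero factor into the products of both
    classes.\<close>
  case False
  then have zero: "(\<Prod>j\<in>UNIV. if 2 * n j dvd \<gamma> j then parity_sign (\<gamma> j div (2 * n j)) (\<kappa> j + int r) else 0) = 0" for r
    by (intro prod_zero) auto
  then show ?thesis
    unfolding sum_node_indices sum_node_indices_parity_mcheb[of n, OF n] zero by simp
next
  case True
  define h where "h j = \<gamma> j div (2 * n j)" for j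
  have "2 * n j * h j = \<gamma> j" for j
    unfolding h_def using True by (intro dvd_mult_div_cancel) auto
  then have "\<gamma> j = 2 * h j * n j" for j
    by (metis mult.assoc mult.commute)
  with nex have odd: "odd (\<Sum>j\<in>UNIV. h j)"
    by blast
  \<comment> \<open>Passing to the other class flips the sign exactly at odd \<open>h j\<close>. As
    the sum of the \<open>h j\<close> is odd, the two products are opposite.\<close>
  have "parity_sign (h j) (\<kappa> j + int 1) = (-1) ^ h j * parity_sign (h j) (\<kappa> j)" for j
    by (simp add: parity_sign_def)
  then have "(\<Prod>j\<in>UNIV. parity_sign (h j) (\<kappa> j + int 1)) =
      (-1) ^ (\<Sum>j\<in>UNIV. h j) * (\<Prod>j\<in>UNIV. parity_sign (h j) (\<kappa> j))"
    by (simp add: prod.distrib power_sum)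
  then show ?thesis
    unfolding sum_node_indices sum_node_indices_parity_mcheb[of n, OF n]
    using True odd by (simp flip: h_def)
qed

section \<open>Comparison of integral and quadrature, coefficient by coefficient\<close>

theorem theorem3p12:
  fixes n :: "'d::finite \<Rightarrow> nat"
    and \<kappa> :: "'d \<Rightarrow> int"
    and P :: "real ^ 'd \<Rightarrow> complex"
  assumes "\<And>j. n j \<ge> 1"
    and "\<And>i j. i \<noteq> j \<Longrightarrow> coprime (n i) (n j)"
    and "polynomial_function P"
    and "\<And>\<gamma> :: 'd \<Rightarrow> nat.
           \<gamma> \<noteq> (\<lambda>_. 0) \<Longrightarrow>
           \<exists>h :: 'd \<Rightarrow> nat. (\<forall>i. \<gamma> i = 2 * h i * n i) \<and> even (\<Sum>i\<in>UNIV. h i) \<Longrightarrow>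
           cheb_inner P (\<lambda>x. of_real (mcheb \<gamma> x)) = 0"
  shows "cheb_integral P =
    (\<Sum>i\<in>node_indices n \<kappa>. of_real (node_weight n i) * P (node n i))"
proof -
  obtain S c where S: "finite S" and P: "\<And>x. x \<in> sym_cube \<Longrightarrow> P x = (\<Sum>\<gamma>\<in>S. c \<gamma> * of_real (mcheb \<gamma> x))"
    using mcheb_span_polynomial_function[OF assms(3)] unfolding mcheb_span_def by blast
  \<comment> \<open>By orthogonality the inner product with T_\<delta> is \<open>c \<delta>\<close>
    times the squared norm \<open>?N \<delta>\<close>.\<close>
  have coeff: "c \<delta> = 0" if \<delta>: "\<delta> \<in> S" and "cheb_inner P (\<lambda>x. of_real (mcheb \<delta> x)) = 0" for \<delta>
  proof -
    let ?N = "\<lambda>\<gamma> :: 'd \<Rightarrow> nat. of_nat (card {B. \<forall>i\<in>B. \<gamma> i = 0}) / 2 ^ CARD('d) :: complex"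
    have "has_cheb_integral (\<lambda>x. \<Sum>\<gamma>\<in>S. c \<gamma> * (of_real (mcheb \<gamma> x) * of_real (mcheb \<delta> x)))
        (\<Sum>\<gamma>\<in>S. c \<gamma> * (if \<gamma> = \<delta> then ?N \<gamma> else 0))"
      by (intro has_cheb_integral_sum has_cheb_integral_mult_right has_cheb_integral_mcheb_mult)
    then have "has_cheb_integral (\<lambda>x. P x * cnj (of_real (mcheb \<delta> x)))
        (\<Sum>\<gamma>\<in>S. c \<gamma> * (if \<gamma> = \<delta> then ?N \<gamma> else 0))"
      by (rule has_cheb_integral_cong) (simp add: P sum_distrib_right mult.assoc)
    moreover have "(\<Sum>\<gamma>\<in>S. c \<gamma> * (if \<gamma> = \<delta> then ?N \<gamma> else 0)) = c \<delta> * ?N \<delta>"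
      using S \<delta> by (simp add: if_distrib[of "(*) _"] sum.delta cong: if_cong)
    ultimately have "c \<delta> * ?N \<delta> = 0"
      using that(2) by (simp add: cheb_inner_def cheb_integral_eq)
    \<comment> \<open>The empty set makes the count positive, so the norm can be cancelled.\<close>
    moreover have "{} \<in> {B. \<forall>i\<in>B. \<delta> i = 0}"
      by simp
    then have "?N \<delta> \<noteq> 0"
      by (auto simp: card_eq_0_iff simp del: mem_Collect_eq)
    ultimately show ?thesis
      by (simp only: mult_eq_0_iff simp_thms)
  qed
  \<comment> \<open>The factor \<open>c \<gamma>\<close> stays on both sides because the quadrature
    of T_\<gamma> itself may be wrong at the indices of the orthogonality hypothesis; there
    \<open>c \<gamma>\<close> is 0.\<close>
  have quadrature: "c \<gamma> * of_real (\<Sum>i\<in>node_indices n \<kappa>. node_weight n i * mcheb \<gamma> (node n i)) =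
      c \<gamma> * of_bool (\<gamma> = (\<lambda>_. 0))" if "\<gamma> \<in> S" for \<gamma>
  proof (cases "\<gamma> = (\<lambda>_. 0)")
    case True
    then show ?thesis
      by (simp only: sum_node_indices_mcheb_0[of n, OF assms(1)]) simp
  next
    case \<gamma>: False
    show ?thesis
    proof (cases "\<exists>h. (\<forall>i. \<gamma> i = 2 * h i * n i) \<and> even (\<Sum>i\<in>UNIV. h i)")
      case True
      then show ?thesis
        using coeff[OF that assms(4)[OF \<gamma>]] by simp
    next
      case False
      then show ?thesis
        using \<gamma> sum_node_indices_mcheb_eq_0[of n \<gamma> \<kappa>, OF assms(1)]
        by (simp only: of_real_0 of_bool_eq if_False simp_thms)
    qed
  qed
  \<comment> \<open>Needed to evaluate the expansion of \<open>P\<close> at the nodes, as it holds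
    on the cube only.\<close>
  have node: "node n i \<in> sym_cube" for i
    by (simp add: mem_sym_cube node_def)
  have "has_cheb_integral P (\<Sum>\<gamma>\<in>S. c \<gamma> * of_bool (\<gamma> = (\<lambda>_. 0)))"
    by (rule has_cheb_integral_cong[of "\<lambda>x. \<Sum>\<gamma>\<in>S. c \<gamma> * of_real (mcheb \<gamma> x)"])
       (simp_all add: P has_cheb_integral_sum has_cheb_integral_mult_right has_cheb_integral_mcheb del: of_bool_eq_iff)
  then have "cheb_integral P = (\<Sum>\<gamma>\<in>S. c \<gamma> * of_bool (\<gamma> = (\<lambda>_. 0)))"
    by (rule cheb_integral_eq)
  also have "\<dots> = (\<Sum>\<gamma>\<in>S. c \<gamma> * of_real (\<Sum>i\<in>node_indices n \<kappa>. node_weight n i * mcheb \<gamma> (node n i)))"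
    by (intro sum.cong refl) (simp only: quadrature)
  also have "\<dots> = (\<Sum>i\<in>node_indices n \<kappa>. \<Sum>\<gamma>\<in>S. c \<gamma> * of_real (node_weight n i * mcheb \<gamma> (node n i)))"
    by (simp only: of_real_sum sum_distrib_left) (rule sum.swap)
  also have "\<dots> = (\<Sum>i\<in>node_indices n \<kappa>. of_real (node_weight n i) * P (node n i))"
    by (simp add: P[OF node] sum_distrib_left mult.left_commute)
  finally show ?thesis .
qed

end
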